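(* Let $\mathcal{V}$ be a vector space over a field $\mathcal{F}$ and let $\mathcal{B}$ be a basis for $\mathcal{V}$. For each nonempty finite subset $\mathcal{X}=\{x_1,\ldots,x_p\}$ of $p$ elements of $\mathcal{B}$ (with a fixed enumeration), consider the $K=p!$ independent basis monomials of degree $p$ obtained by multiplying together the elements of $\mathcal{X}$ in all possible orders. Let $\mathcal{T}_1=\{t_1,t_3,\ldots,t_{K-1}\}$ be those that are of the same parity as $t_1=x_1\otimes\cdots\otimes x_p$, let $\mathcal{T}_2=\{t_2,t_4,\ldots,t_K\}$ be those of parity opposite to $t_1$ (for $p=1$, $\mathcal{T}_1=\{t_1\}$ and $\mathcal{T}_2=\varnothing$), and let $$\mathcal{T}=\{t_1,\;t_1+t_2,\;t_2+t_3,\;\ldots,\;t_{K-1}+t_K\}.$$ Then $\langle\mathcal{T}\rangle=\langle\mathcal{T}_1\cup\mathcal{T}_2\rangle$, and if $s\in\mathcal{T}_1$ and $t\in\mathcal{T}_2$, then $s+t\in\langle\mathcal{T}\smallsetminus\{t_1\}\rangle$. Moreover, let $\mathcal{A}_0$ denote the set of all dependent basis monomials based on $\mathcal{B}$, let $\mathcal{A}_1$ denote the union of all the sets $\mathcal{T}\smallsetminus\{t_1\}$ (over all such $\mathcal{X}$, for all $p$), and let $\mathcal{E}$ denote the union of all the singleton sets $\{t_1\}$ (over all such $\mathcal{X}$, for all $p$) and $\{1\}$. Then $\mathcal{A}_0\cup\mathcal{A}_1\cup\mathcal{E}$ is a basis for $\bigotimes\mathcal{V}$, $\mathcal{A}_0\cup\mathcal{A}_1$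 is a basis for the ideal $\mathcal{D}$ of all linear combinations of dependent e-products in $\bigotimes\mathcal{V}$, and $\mathcal{E}$ is a basis for a complementary subspace of $\mathcal{D}$.
   Context: $\bigotimes\mathcal{V}=\bigoplus_{k\geqslant 0}\bigotimes^k\mathcal{V}$ is the (contravariant) tensor algebra of $\mathcal{V}$, with $\bigotimes^0\mathcal{V}=\mathcal{F}$ and $\bigotimes^1\mathcal{V}=\mathcal{V}$. $\langle\mathcal{S}\rangle$ denotes the linear span of $\mathcal{S}$. An e-product of degree $p>0$ is an element of the form $v_1\otimes\cdots\otimes v_p$ with each $v_i\in\mathcal{V}$; it is called dependent if the sequence $v_1,\ldots,v_p$ is dependent (i.e. the set $\{v_1,\ldots,v_p\}$ is linearly dependent or some of the $v_i$ are equal), and independent otherwise. A basis monomial of degree $p$ (based on $\mathcal{B}$) is an e-product of degree $p$ all of whose factors belong to $\mathcal{B}$; thus it is dependent exactly when some basis vector is repeated. Two e-products $v_1\otimes\cdots\otimes v_p$ and $v_{\sigma(1)}\otimes\cdots\otimes v_{\sigma(p)}$ are of the same parity, or of opposite parity, according as the permutation $\sigma$ of $\{1,\ldots,p\}$ is even or odd. *)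

theory Defs
  imports Complex_Main "HOL-Combinatorics.Permutations"
begin

section \<open>Bases and complementary subspaces\<close>

definition is_basis_of ::
    "('f::field \<Rightarrow> 'a::ab_group_add \<Rightarrow> 'a) \<Rightarrow> 'a set \<Rightarrow> 'a set \<Rightarrow> bool" where
  "is_basis_of scale A W \<longleftrightarrow> \<not> module.dependent scale A \<and> module.span scale A = W"

definition complementary_subspaces ::
    "('f::field \<Rightarrow> 'a::ab_group_add \<Rightarrow> 'a) \<Rightarrow> 'a set \<Rightarrow> 'a set \<Rightarrow> bool" where
  "complementary_subspaces scale U W \<longleftrightarrow>
     module.subspace scale U \<and> module.subspace scale W \<and>
     U \<inter> W = {0} \<and> {u + w | u w. u \<in> U \<and> w \<in> W} = UNIV"

definition two_sided_ideal :: "'a::ring_1 set \<Rightarrow> bool" where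
  "two_sided_ideal I \<longleftrightarrow>
     0 \<in> I \<and> (\<forall>x\<in>I. \<forall>y\<in>I. x + y \<in> I) \<and> (\<forall>x\<in>I. \<forall>a. a * x \<in> I \<and> x * a \<in> I)"


section \<open>The tensor algebra of a vector space\<close>

text \<open>Multilinearity of a map in \<open>k\<close> vector arguments, given as a function on lists of which only
  the values at lists of length \<open>k\<close> matter.\<close>

definition multilinear_map ::
    "('f::field \<Rightarrow> 'v::ab_group_add \<Rightarrow> 'v) \<Rightarrow> ('f \<Rightarrow> 'w::ab_group_add \<Rightarrow> 'w) \<Rightarrow> nat \<Rightarrow>
     ('v list \<Rightarrow> 'w) \<Rightarrow> bool" where
  "multilinear_map sV sW k f \<longleftrightarrow>
     (\<forall>us ws. length us + Suc (length ws) = k \<longrightarrow>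
        Vector_Spaces.linear sV sW (\<lambda>v. f (us @ v # ws)))"

definition e_product :: "('v \<Rightarrow> 't::ring_1) \<Rightarrow> 'v list \<Rightarrow> 't" where
  "e_product \<iota> vs = prod_list (map \<iota> vs)"

definition tensor_power ::
    "('f::field \<Rightarrow> 't \<Rightarrow> 't) \<Rightarrow> ('v \<Rightarrow> 't::ring_1) \<Rightarrow> nat \<Rightarrow> 't set" where
  "tensor_power sT \<iota> k = module.span sT {e_product \<iota> vs | vs. length vs = k}"

text \<open>The scalar multiplication of \<open>V\<close> is a term, so no type can be built from it that would carry
  the tensor algebra of \<open>V\<close>.  Instead, an algebra \<open>T\<close> with a linear map \<open>\<iota>\<close> from \<open>V\<close> is said to be
  the tensor algebra of \<open>V\<close> if it is the direct sum of subspaces, the \<open>k\<close>-th of which is a \<open>k\<close>-th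
  tensor power of \<open>V\<close> (universal property) by way of the \<open>k\<close>-fold multiplication of \<open>T\<close>.

  For \<open>k = 0\<close> the universal property identifies \<open>tensor_power sT \<iota> 0\<close>, the multiples of \<open>1\<close>, with the
  field, and for \<open>k = 1\<close> it makes \<open>\<iota>\<close> an isomorphism onto \<open>tensor_power sT \<iota> 1\<close>.

  A locale assumption cannot quantify over types, so the universal property is required only for maps
  into \<open>T\<close>; lemma \<open>universal_any\<close> below derives it for maps into arbitrary vector spaces.  Uniqueness
  of the linear map on \<open>tensor_power sT \<iota> k\<close> holds because this space is spanned by e-products.\<close>

locale tensor_algebra =
  V: vector_space sV + T: vector_space sT + incl: Vector_Spaces.linear sV sT \<iota>
  for sV :: "'f::field \<Rightarrow> 'v::ab_group_add \<Rightarrow> 'v"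
    and sT :: "'f \<Rightarrow> 't::ring_1 \<Rightarrow> 't"
    and \<iota> :: "'v \<Rightarrow> 't" +
  assumes scale_mult_left: "sT c x * y = sT c (x * y)"
    and scale_mult_right: "x * sT c y = sT c (x * y)"
    and sum_tensor_powers: "module.span sT (\<Union>k. tensor_power sT \<iota> k) = UNIV"
    and direct_tensor_powers:
      "(\<And>k. z k \<in> tensor_power sT \<iota> k) \<Longrightarrow> (\<Sum>k\<le>n. z k) = 0 \<Longrightarrow> k \<le> n \<Longrightarrow> z k = 0"
    and universal:
      "multilinear_map sV sT k f \<Longrightarrow>
         \<exists>g. Vector_Spaces.linear sT sT g \<and> (\<forall>vs. length vs = k \<longrightarrow> g (e_product \<iota> vs) = f vs)"
begin

lemma linear_sandwich: "Vector_Spaces.linear sV sT (\<lambda>v. e_product \<iota> (us @ v # ws))"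
  by unfold_locales
    (simp_all add: e_product_def incl.add incl.scale distrib_left distrib_right
      scale_mult_left scale_mult_right)

lemma multilinear_e_product: "multilinear_map sV sT k (e_product \<iota>)"
  by (simp add: multilinear_map_def linear_sandwich)

lemma multilinear_maps_agree:
  assumes f: "multilinear_map sV sU k f" and g: "multilinear_map sV sU k g"
    and B: "V.span B = UNIV"
    and eq: "\<And>w. length w = k \<Longrightarrow> set w \<subseteq> B \<Longrightarrow> f w = g w"
    and len: "length vs = k"
  shows "f vs = g vs"
proof -
  have "f vs = g vs" if "length vs = k" "set (drop n vs) \<subseteq> B" "n \<le> k" for n vs
    using that
  proof (induction n arbitrary: vs)
    case 0
    then show ?case by (simp add: eq)
  next
    case (Suc n)
    define us v ws where "us = take n vs" and "v = vs ! n" and "ws = drop (Suc n) vs"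
    have vs: "vs = us @ v # ws"
      using Suc.prems by (simp add: us_def v_def ws_def id_take_nth_drop)
    have lus: "length us = n" using Suc.prems by (simp add: us_def)
    have ll: "length us + Suc (length ws) = k" using Suc.prems vs lus by simp
    have fl: "Vector_Spaces.linear sV sU (\<lambda>v. f (us @ v # ws))"
      and gl: "Vector_Spaces.linear sV sU (\<lambda>v. g (us @ v # ws))"
      using f g ll by (auto simp: multilinear_map_def)
    interpret f: Vector_Spaces.linear sV sU "\<lambda>v. f (us @ v # ws)" by (rule fl)
    interpret vector_space_pair sV sU ..
    have "f (us @ b # ws) = g (us @ b # ws)" if "b \<in> B" for b
    proof (rule Suc.IH)
      show "set (drop n (us @ b # ws)) \<subseteq> B"
        using that Suc.prems(2) lus by (simp add: ws_def)
    qed (use ll Suc.prems in auto)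
    then show ?case
      unfolding vs using linear_eq_on[OF fl gl, of v B] B by blast
  qed
  from this[of vs k] show ?thesis by (simp add: len)
qed

lemma universal_any:
  fixes sU :: "'f \<Rightarrow> 'u::ab_group_add \<Rightarrow> 'u"
  assumes U: "vector_space sU" and f: "multilinear_map sV sU k f"
  shows "\<exists>g. Vector_Spaces.linear sT sU g \<and> (\<forall>vs. length vs = k \<longrightarrow> g (e_product \<iota> vs) = f vs)"
proof -
  interpret U: vector_space sU by (rule U)
  interpret TU: vector_space_pair sT sU ..
  obtain B where "V.independent B" "UNIV \<subseteq> V.span B"
    by (rule V.maximal_independent_subset)
  then have B: "V.independent B" "V.span B = UNIV" by auto
  define W where "W = {w. length w = k \<and> set w \<subseteq> B}"
  define coord where "coord w vs = prod_list (map2 (\<lambda>b v. V.representation B v b) w vs)" for w vs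
  have coord_basis: "coord w w' = (if w = w' then 1 else 0)"
    if "length w = length w'" "set w' \<subseteq> B" for w w'
    using that
    by (induction w w' rule: list_induct2) (auto simp: coord_def V.representation_basis[OF B(1)])
  have ml: "multilinear_map sV sT k (\<lambda>vs. sT (coord w vs) 1)" if w: "length w = k" for w
    unfolding multilinear_map_def
  proof (intro allI impI)
    fix us ws :: "'v list"
    assume len: "length us + Suc (length ws) = k"
    define w1 b w2 where "w1 = take (length us) w" and "b = w ! length us"
      and "w2 = drop (Suc (length us)) w"
    have weq: "w = w1 @ b # w2"
      using w len by (simp add: w1_def b_def w2_def id_take_nth_drop)
    have l1: "length w1 = length us" using w len by (simp add: w1_def)
    have c: "coord w (us @ v # ws) = coord w1 us * V.representation B v b * coord w2 ws" for v
      using l1 by (simp add: coord_def weq mult.assoc)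
    show "Vector_Spaces.linear sV sT (\<lambda>v. sT (coord w (us @ v # ws)) 1)"
      unfolding c
      by unfold_locales
        (simp_all add: V.representation_add[OF B(1)] V.representation_scale[OF B(1)] B(2)
          T.scale_left_distrib algebra_simps)
  qed
  have ex: "\<exists>g. Vector_Spaces.linear sT sT g \<and>
      (\<forall>w'\<in>W. g (e_product \<iota> w') = (if w = w' then 1 else 0))" if w: "w \<in> W" for w
  proof -
    obtain g where "Vector_Spaces.linear sT sT g"
      "\<forall>vs. length vs = k \<longrightarrow> g (e_product \<iota> vs) = sT (coord w vs) 1"
      using universal[OF ml, of w] w by (auto simp: W_def)
    then show ?thesis
      using w by (intro exI[of _ g]) (auto simp: W_def coord_basis)
  qed
  have inj: "inj_on (e_product \<iota>) W"
  proof (rule inj_onI)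
    fix w w' assume ww: "w \<in> W" "w' \<in> W" "e_product \<iota> w = e_product \<iota> w'"
    from ex[OF ww(1)] obtain g
      where "\<forall>w'\<in>W. g (e_product \<iota> w') = (if w = w' then (1::'t) else 0)" by blast
    with ww show "w = w'" by (metis zero_neq_one)
  qed
  have ind: "T.independent (e_product \<iota> ` W)"
    unfolding T.independent_explicit_finite_subsets
  proof (intro allI impI ballI)
    fix S c s
    assume S: "S \<subseteq> e_product \<iota> ` W" "finite S" and 0: "(\<Sum>v\<in>S. sT (c v) v) = 0" and s: "s \<in> S"
    obtain w where w: "w \<in> W" "s = e_product \<iota> w" using S s by blast
    from ex[OF w(1)] obtain g where g: "Vector_Spaces.linear sT sT g"
      "\<forall>w'\<in>W. g (e_product \<iota> w') = (if w = w' then 1 else 0)" by blast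
    interpret g: Vector_Spaces.linear sT sT g by (rule g(1))
    have "g v = (if v = s then 1 else 0)" if "v \<in> S" for v
      using that S w g(2) inj by (auto simp: inj_on_def)
    then have "(\<Sum>v\<in>S. sT (c v) (g v)) = (\<Sum>v\<in>S. if v = s then sT (c v) 1 else 0)"
      by (intro sum.cong) auto
    also have "\<dots> = sT (c s) 1" using S s by simp
    finally have "sT (c s) 1 = g (\<Sum>v\<in>S. sT (c v) v)"
      by (simp add: g.sum g.scale)
    then show "c s = 0" using 0 by simp
  qed
  obtain g where g: "Vector_Spaces.linear sT sU g"
    "\<forall>x\<in>e_product \<iota> ` W. g x = f (the_inv_into W (e_product \<iota>) x)"
    using TU.linear_independent_extend[OF ind, of "\<lambda>x. f (the_inv_into W (e_product \<iota>) x)"]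
    by blast
  interpret g: Vector_Spaces.linear sT sU g by (rule g(1))
  have gml: "multilinear_map sV sU k (\<lambda>vs. g (e_product \<iota> vs))"
    unfolding multilinear_map_def
  proof (intro allI impI)
    fix us ws
    interpret l: Vector_Spaces.linear sV sT "\<lambda>v. e_product \<iota> (us @ v # ws)"
      by (rule linear_sandwich)
    show "Vector_Spaces.linear sV sU (\<lambda>v. g (e_product \<iota> (us @ v # ws)))"
      by unfold_locales (simp_all add: l.add l.scale g.add g.scale)
  qed
  have "g (e_product \<iota> vs) = f vs" if "length vs = k" for vs
    by (rule multilinear_maps_agree[OF gml f B(2) _ that])
      (use g(2) inj in \<open>auto simp: W_def the_inv_into_f_f\<close>)
  with g(1) show ?thesis by blast
qed

end


section \<open>Dependent e-products and basis monomials\<close>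

definition dependent_seq ::
    "('f::field \<Rightarrow> 'v::ab_group_add \<Rightarrow> 'v) \<Rightarrow> 'v list \<Rightarrow> bool" where
  "dependent_seq sV vs \<longleftrightarrow> module.dependent sV (set vs) \<or> \<not> distinct vs"

definition dependent_e_products ::
    "('f::field \<Rightarrow> 'v::ab_group_add \<Rightarrow> 'v) \<Rightarrow> ('v \<Rightarrow> 't::ring_1) \<Rightarrow> 't set" where
  "dependent_e_products sV \<iota> = {e_product \<iota> vs | vs. vs \<noteq> [] \<and> dependent_seq sV vs}"

definition dependent_basis_monomials ::
    "('f::field \<Rightarrow> 'v::ab_group_add \<Rightarrow> 'v) \<Rightarrow> ('v \<Rightarrow> 't::ring_1) \<Rightarrow> 'v set \<Rightarrow> 't set" where
  "dependent_basis_monomials sV \<iota> B =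
     {e_product \<iota> vs | vs. vs \<noteq> [] \<and> set vs \<subseteq> B \<and> dependent_seq sV vs}"


section \<open>Monomials on a finite set of basis vectors\<close>

text \<open>The list \<open>xs = [x\<^sub>1, \<dots>, x\<^sub>p]\<close> is the fixed enumeration of the finite set.\<close>

definition same_parity_monomials :: "('v \<Rightarrow> 't::ring_1) \<Rightarrow> 'v list \<Rightarrow> 't set" where
  "same_parity_monomials \<iota> xs =
     {e_product \<iota> (permute_list \<sigma> xs) | \<sigma>. \<sigma> permutes {..<length xs} \<and> evenperm \<sigma>}"

definition opposite_parity_monomials :: "('v \<Rightarrow> 't::ring_1) \<Rightarrow> 'v list \<Rightarrow> 't set" where
  "opposite_parity_monomials \<iota> xs =
     {e_product \<iota> (permute_list \<sigma> xs) | \<sigma>. \<sigma> permutes {..<length xs} \<and> \<not> evenperm \<sigma>}"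

text \<open>\<open>t 1, \<dots>, t K\<close> with \<open>K = p!\<close> enumerates the monomials without repetition, starting with
  \<open>x\<^sub>1 \<otimes> \<dots> \<otimes> x\<^sub>p\<close>, and those of its parity get the odd indices.\<close>

definition monomial_enumeration :: "('v \<Rightarrow> 't::ring_1) \<Rightarrow> 'v list \<Rightarrow> (nat \<Rightarrow> 't) \<Rightarrow> bool" where
  "monomial_enumeration \<iota> xs t \<longleftrightarrow>
     t 1 = e_product \<iota> xs \<and>
     bij_betw t {i \<in> {1..fact (length xs)}. odd i} (same_parity_monomials \<iota> xs) \<and>
     bij_betw t {i \<in> {1..fact (length xs)}. even i} (opposite_parity_monomials \<iota> xs)"

definition chain_set :: "nat \<Rightarrow> (nat \<Rightarrow> 't::ring_1) \<Rightarrow> 't set" where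
  "chain_set K t = {t 1} \<union> {t i + t (Suc i) | i. 1 \<le> i \<and> i < K}"

definition nonempty_finite_subsets :: "'v set \<Rightarrow> 'v set set" where
  "nonempty_finite_subsets B = {X. X \<subseteq> B \<and> finite X \<and> X \<noteq> {}}"

end

theory Submission
  imports Defs
begin

text \<open>The monomials on \<open>B\<close>, dependent and independent ones together with \<open>1\<close>, form a basis of the tensor
  algebra (\<open>independent_monomials\<close>, \<open>span_monomials\<close>): the universal property turns products of
  coordinates into functionals that separate the words of equal length, and the direct sum separates
  the lengths.

  Within the monomials on a set \<open>X\<close>, replacing \<open>t\<^sub>i\<^sub>+\<^sub>1\<close> by \<open>t\<^sub>i + t\<^sub>i\<^sub>+\<^sub>1\<close> adds only a monomial that comes
  earlier in the enumeration.  Such a unitriangular change turns a basis into a basis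
  (\<open>unitriangular_change_of_basis\<close>), even with infinitely many sets \<open>X\<close> at once.  So
  \<open>A\<^sub>0 \<union> A\<^sub>1 \<union> E\<close> is a basis of the algebra, and any splitting of a basis into two parts gives
  complementary subspaces.  It remains to identify \<open>D\<close> with the span of \<open>A\<^sub>0 \<union> A\<^sub>1\<close>.

  This rests on the span \<open>N\<close> of the monomials with a repeated letter and of the sums of two monomials
  that differ by exchanging adjacent letters.  The generators make \<open>N\<close> a two-sided ideal.  Modulo
  \<open>N\<close> basis vectors anticommute and have square \<open>0\<close>; both properties pass to all vectors by
  linearity, so that every dependent e-product vanishes modulo \<open>N\<close> and \<open>D \<subseteq> N\<close>
  (\<open>dependent_ideal_subset_span_alternating_relations\<close>).  Exchanging two letters reverses the parity,
  and the sum of two monomials of opposite parity is an alternating sum of consecutive chain sums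
  (\<open>opposite_parity_sum_in\<close>), whence \<open>N \<subseteq> \<langle>A\<^sub>0 \<union> A\<^sub>1\<rangle>\<close>.  Finally, expanding a product with the
  factor \<open>a + b\<close> in two places shows that exchanging two factors changes the sign modulo \<open>D\<close>; hence a
  permutation acts by its sign, sums of monomials of opposite parity lie in \<open>D\<close>, and
  \<open>\<langle>A\<^sub>0 \<union> A\<^sub>1\<rangle> \<subseteq> D\<close>.  The signs are kept as sums and differences, so that no case
  distinction on the characteristic arises.\<close>

section \<open>Bases of vector spaces\<close>

context vector_space
begin

text \<open>In a vanishing combination, take an index of greatest rank among those with nonzero coefficient:
  no other summand involves the basis vector of this index, so its coefficient is \<open>0\<close> after all.\<close>

lemma independent_unitriangular_sum:
  fixes r :: "'b \<Rightarrow> nat"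
  assumes ind: "independent M"
    and tri: "\<And>m. m \<in> M \<Longrightarrow> \<phi> m - m \<in> span {m' \<in> M. r m' < r m}"
    and S: "finite S" "S \<subseteq> M" and 0: "(\<Sum>m\<in>S. scale (c m) (\<phi> m)) = 0" and "s \<in> S"
  shows "c s = 0"
proof (rule ccontr)
  assume "c s \<noteq> 0"
  define S' where "S' = {m \<in> S. c m \<noteq> 0}"
  have fin: "finite S'" and sub: "S' \<subseteq> M" and ne: "S' \<noteq> {}"
    using S \<open>s \<in> S\<close> \<open>c s \<noteq> 0\<close> by (auto simp: S'_def)
  have "Max (r ` S') \<in> r ` S'" using fin ne by simp
  then obtain m where m: "m \<in> S'" "r m = Max (r ` S')" by auto
  have max: "r m' \<le> r m" if "m' \<in> S'" for m'
    using that fin m(2) by simp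
  have low: "{m'' \<in> M. r m'' < r m'} \<subseteq> M" for m' by auto
  have in_span: "\<phi> m' \<in> span M" if "m' \<in> M" for m'
  proof -
    have "\<phi> m' - m' \<in> span M" using tri[OF that] span_mono[OF low] by blast
    from span_add[OF this span_base[OF that]] show ?thesis by simp
  qed
  have rep: "representation M (\<phi> m') m = (if m' = m then 1 else 0)" if m': "m' \<in> S'" for m'
  proof -
    have m'M: "m' \<in> M" using m' sub by auto
    have "representation M (\<phi> m' - m') m = representation {m'' \<in> M. r m'' < r m'} (\<phi> m' - m') m"
      using representation_extend[OF ind tri[OF m'M] low] by simp
    also have "\<dots> = 0"
      using representation_ne_zero[of "{m'' \<in> M. r m'' < r m'}" "\<phi> m' - m'" m] max[OF m'] by auto
    finally show ?thesis
      using representation_diff[OF ind span_base[OF m'M] in_span[OF m'M]]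
        representation_basis[OF ind m'M] by (auto split: if_splits)
  qed
  have "0 = (\<Sum>m'\<in>S. scale (c m') (\<phi> m'))" using 0 by simp
  also have "\<dots> = (\<Sum>m'\<in>S'. scale (c m') (\<phi> m'))"
    using S by (intro sum.mono_neutral_right) (auto simp: S'_def)
  finally have "0 = representation M (\<Sum>m'\<in>S'. scale (c m') (\<phi> m')) m"
    by (metis representation_zero)
  also have "\<dots> = (\<Sum>m'\<in>S'. representation M (scale (c m') (\<phi> m')) m)"
    using sub in_span by (subst representation_sum[OF ind]) (auto intro: span_scale)
  also have "\<dots> = (\<Sum>m'\<in>S'. c m' * (if m' = m then 1 else 0))"
    using sub in_span rep by (intro sum.cong) (auto simp: representation_scale[OF ind])
  also have "\<dots> = c m" using fin m by (simp add: if_distrib cong: if_cong)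
  finally show False using m by (simp add: S'_def)
qed

text \<open>The change from the monomials to the chain sets is of this kind, the rank of a monomial being its
  position in its chain.  Induction on the rank recovers the old basis from the new one, for all chains at
  once.\<close>

lemma unitriangular_change_of_basis:
  fixes r :: "'b \<Rightarrow> nat"
  assumes ind: "independent M"
    and tri: "\<And>m. m \<in> M \<Longrightarrow> \<phi> m - m \<in> span {m' \<in> M. r m' < r m}"
  shows "inj_on \<phi> M" and "independent (\<phi> ` M)" and "span (\<phi> ` M) = span M"
proof -
  note zero = independent_unitriangular_sum[OF ind tri]
  show inj: "inj_on \<phi> M"
  proof (rule inj_onI, rule ccontr)
    fix m m' assume *: "m \<in> M" "m' \<in> M" "\<phi> m = \<phi> m'" "m \<noteq> m'"
    define c :: "'b \<Rightarrow> 'a" where "c = (\<lambda>n. if n = m then 1 else - 1)"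
    have "(\<Sum>n\<in>{m, m'}. scale (c n) (\<phi> n)) = 0" using * by (simp add: c_def)
    from zero[OF _ _ _ this, of m] * show False by (simp add: c_def)
  qed
  show "independent (\<phi> ` M)"
    unfolding independent_explicit_finite_subsets
  proof (intro allI impI ballI)
    fix S c s
    assume S: "S \<subseteq> \<phi> ` M" "finite S" and 0: "(\<Sum>v\<in>S. scale (c v) v) = 0" and s: "s \<in> S"
    obtain R where R: "R \<subseteq> M" "finite R" "S = \<phi> ` R"
      using finite_subset_image[OF S(2,1)] by blast
    have "inj_on \<phi> R" using inj R(1) by (rule inj_on_subset)
    then have "(\<Sum>m\<in>R. scale (c (\<phi> m)) (\<phi> m)) = 0"
      using 0 unfolding R(3) by (simp add: sum.reindex)
    from zero[OF _ R(2,1) this] show "c s = 0" using s R(3) by auto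
  qed
  show "span (\<phi> ` M) = span M"
  proof (unfold span_eq, intro conjI subsetI)
    fix a assume "a \<in> \<phi> ` M"
    then obtain m where m: "m \<in> M" "a = \<phi> m" by blast
    have "\<phi> m - m \<in> span M"
      using tri[OF m(1)] span_mono[of "{m' \<in> M. r m' < r m}" M] by blast
    from span_add[OF this span_base[OF m(1)]] show "a \<in> span M" by (simp add: m)
  next
    fix m assume "m \<in> M"
    then show "m \<in> span (\<phi> ` M)"
    proof (induction "r m" arbitrary: m rule: less_induct)
      case less
      have "span {m' \<in> M. r m' < r m} \<subseteq> span (\<phi> ` M)"
        by (rule span_minimal) (use less.hyps in auto)
      then have "\<phi> m - m \<in> span (\<phi> ` M)" using tri[OF less.prems] by blast
      from span_diff[OF span_base[OF imageI[OF less.prems]] this] show ?case by simp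
    qed
  qed
qed

lemma complementary_spans:
  assumes ind: "independent (A \<union> E)" and disj: "A \<inter> E = {}" and span: "span (A \<union> E) = UNIV"
  shows "complementary_subspaces scale (span A) (span E)"
proof -
  have "z = 0" if z: "z \<in> span A" "z \<in> span E" for z
  proof -
    have "representation (A \<union> E) z b = 0" for b
      using representation_extend[OF ind z(1)] representation_extend[OF ind z(2)] disj
        representation_ne_zero[of A z b] representation_ne_zero[of E z b] by auto
    then show ?thesis
      using sum_nonzero_representation_eq[OF ind, of z] span by simp
  qed
  then show ?thesis
    using span span_Un[of A E] by (auto simp: complementary_subspaces_def span_zero)
qed

end

section \<open>Permutations of lists\<close>

lemma permute_list_inj:
  assumes "distinct xs" and \<sigma>: "\<sigma> permutes {..<length xs}" and \<tau>: "\<tau> permutes {..<length xs}"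
    and eq: "permute_list \<sigma> xs = permute_list \<tau> xs"
  shows "\<sigma> = \<tau>"
proof
  fix i
  show "\<sigma> i = \<tau> i"
  proof (cases "i < length xs")
    case True
    then have "xs ! \<sigma> i = xs ! \<tau> i" using eq permute_list_nth[OF \<sigma>] permute_list_nth[OF \<tau>] by metis
    then show ?thesis
      using assms(1) True permutes_in_image[OF \<sigma>, of i] permutes_in_image[OF \<tau>, of i]
      by (simp add: nth_eq_iff_index_eq)
  next
    case False
    then show ?thesis using \<sigma> \<tau> by (simp add: permutes_not_in)
  qed
qed

lemma permute_list_transpose:
  "permute_list (Transposition.transpose (length us) (length us + Suc (length vs)))
     (us @ a # vs @ b # ws) = us @ b # vs @ a # ws"
proof -
  have *: "permute_list (Transposition.transpose i j) xs = xs[i := xs ! j, j := xs ! i]"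
    if "i < length xs" "j < length xs" for i j and xs :: "'a list"
    using that by (intro nth_equalityI) (auto simp: permute_list_def transpose_def nth_list_update)
  show ?thesis
    by (subst *) (simp_all add: list_update_append nth_append)
qed

lemma distinct_eq_permute_list:
  assumes "distinct ys" "distinct xs" "set ys = set xs"
  obtains \<sigma> where "\<sigma> permutes {..<length xs}" "ys = permute_list \<sigma> xs"
proof -
  have "mset ys = mset xs" using assms by (simp add: set_eq_iff_mset_eq_distinct)
  then show ?thesis using mset_eq_permutation that by metis
qed

lemma evenperm_comp_transpose:
  assumes "\<sigma> permutes {..<n::nat}" "i \<noteq> j"
  shows "evenperm (\<sigma> \<circ> Transposition.transpose i j) \<longleftrightarrow> \<not> evenperm \<sigma>"
proof -
  have "permutation \<sigma>" using assms(1) by (auto simp: permutation_permutes)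
  then show ?thesis
    using assms(2) evenperm_comp[OF _ permutation_swap_id] evenperm_swap by metis
qed

section \<open>The monomials on a basis form a basis of the tensor algebra\<close>

context tensor_algebra
begin

abbreviation e :: "'v list \<Rightarrow> 't" where "e \<equiv> e_product \<iota>"

lemma e_Nil [simp]: "e [] = 1"
  and e_Cons: "e (v # vs) = \<iota> v * e vs"
  and e_append: "e (us @ vs) = e us * e vs"
  by (simp_all add: e_product_def)

lemma subspace_vector_factor:
  assumes "T.subspace J"
  shows "V.subspace {v. y * (\<iota> v * z) \<in> J}"
  using assms unfolding V.subspace_def T.subspace_def
  by (simp add: incl.add incl.scale incl.zero distrib_left distrib_right
      scale_mult_left scale_mult_right)

lemma subspace_factor:
  assumes "T.subspace J"
  shows "T.subspace {x. y * x * z \<in> J}"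
  using assms unfolding T.subspace_def
  by (simp add: distrib_left distrib_right scale_mult_left scale_mult_right)

end

locale tensor_algebra_basis = tensor_algebra sV sT \<iota>
  for sV :: "'f::field \<Rightarrow> 'v::ab_group_add \<Rightarrow> 'v"
    and sT :: "'f \<Rightarrow> 't::ring_1 \<Rightarrow> 't"
    and \<iota> :: "'v \<Rightarrow> 't" +
  fixes B :: "'v set"
  assumes indep_B: "V.independent B" and span_B: "V.span B = UNIV"
begin

definition monomials :: "'t set" where
  "monomials = e ` {w. set w \<subseteq> B}"

text \<open>The product of the coordinates of \<open>v\<^sub>1, \<dots>, v\<^sub>k\<close> at the letters of a word is multilinear, so the
  universal property turns it into a functional that singles out this word.\<close>

lemma coordinate_functional:
  assumes w: "set w \<subseteq> B"
  shows "\<exists>g. Vector_Spaces.linear sT sT g \<and>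
    (\<forall>w'. length w' = length w \<and> set w' \<subseteq> B \<longrightarrow> g (e w') = (if w' = w then 1 else 0))"
proof -
  define coord where "coord w vs = prod_list (map2 (\<lambda>b v. V.representation B v b) w vs)" for w vs
  have coord_basis: "coord w w' = (if w' = w then 1 else 0)"
    if "length w = length w'" "set w' \<subseteq> B" for w w'
    using that
    by (induction w w' rule: list_induct2) (auto simp: coord_def V.representation_basis[OF indep_B])
  have "multilinear_map sV sT (length w) (\<lambda>vs. sT (coord w vs) 1)"
    unfolding multilinear_map_def
  proof (intro allI impI)
    fix us ws :: "'v list"
    assume len: "length us + Suc (length ws) = length w"
    define w1 b w2 where "w1 = take (length us) w" and "b = w ! length us"
      and "w2 = drop (Suc (length us)) w"
    have weq: "w = w1 @ b # w2"
      using len by (simp add: w1_def b_def w2_def id_take_nth_drop)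
    have l1: "length w1 = length us" using len by (simp add: w1_def)
    have c: "coord w (us @ v # ws) = coord w1 us * V.representation B v b * coord w2 ws" for v
      using l1 by (simp add: coord_def weq mult.assoc)
    show "Vector_Spaces.linear sV sT (\<lambda>v. sT (coord w (us @ v # ws)) 1)"
      unfolding c
      by unfold_locales
        (simp_all add: V.representation_add[OF indep_B] V.representation_scale[OF indep_B] span_B
          T.scale_left_distrib algebra_simps)
  qed
  from universal[OF this] obtain g where "Vector_Spaces.linear sT sT g"
    "\<forall>vs. length vs = length w \<longrightarrow> g (e vs) = sT (coord w vs) 1" by blast
  then show ?thesis by (intro exI[of _ g]) (auto simp: coord_basis)
qed

text \<open>The tensor powers being independent, the terms of each length sum to \<open>0\<close> separately; a coordinate
  functional then isolates a single coefficient.\<close>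

lemma monomial_sum_eq_0:
  assumes S: "finite S" "\<And>w. w \<in> S \<Longrightarrow> set w \<subseteq> B"
    and 0: "(\<Sum>w\<in>S. sT (c w) (e w)) = 0" and w: "w \<in> S"
  shows "c w = 0"
proof -
  define z where "z k = (\<Sum>w\<in>{w \<in> S. length w = k}. sT (c w) (e w))" for k
  define n where "n = Max (length ` S)"
  have "(\<Sum>k\<le>n. z k) = (\<Sum>w\<in>S. sT (c w) (e w))"
    unfolding z_def by (rule sum.group) (use S(1) in \<open>auto simp: n_def\<close>)
  moreover have "z k \<in> tensor_power sT \<iota> k" for k
    unfolding z_def tensor_power_def by (intro T.span_sum T.span_scale T.span_base) auto
  moreover have "length w \<le> n" using S(1) w by (simp add: n_def)
  ultimately have z0: "z (length w) = 0" using direct_tensor_powers 0 by metis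
  obtain g where g: "Vector_Spaces.linear sT sT g"
    "\<forall>w'. length w' = length w \<and> set w' \<subseteq> B \<longrightarrow> g (e w') = (if w' = w then 1 else 0)"
    using coordinate_functional S(2)[OF w] by blast
  interpret g: Vector_Spaces.linear sT sT g by (rule g(1))
  have "0 = g (z (length w))" by (simp add: z0)
  also have "\<dots> = (\<Sum>w'\<in>{w' \<in> S. length w' = length w}. sT (c w') (g (e w')))"
    by (simp add: z_def g.sum g.scale)
  also have "\<dots> = (\<Sum>w'\<in>{w' \<in> S. length w' = length w}. if w' = w then sT (c w) 1 else 0)"
    using g(2) S(2) by (intro sum.cong) auto
  also have "\<dots> = sT (c w) 1" using S(1) w by simp
  finally show ?thesis by simp
qed

lemma inj_on_words: "inj_on e {w. set w \<subseteq> B}"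
proof (rule inj_onI, rule ccontr)
  fix w w' assume *: "w \<in> {w. set w \<subseteq> B}" "w' \<in> {w. set w \<subseteq> B}" "e w = e w'" "w \<noteq> w'"
  define c :: "'v list \<Rightarrow> 'f" where "c = (\<lambda>u. if u = w then 1 else - 1)"
  have "(\<Sum>u\<in>{w, w'}. sT (c u) (e u)) = 0" using * by (simp add: c_def)
  from monomial_sum_eq_0[OF _ _ this, of w] * show False by (auto simp: c_def)
qed

lemma e_eq_iff: "set w \<subseteq> B \<Longrightarrow> set w' \<subseteq> B \<Longrightarrow> e w = e w' \<longleftrightarrow> w = w'"
  using inj_on_words by (auto simp: inj_on_def)

lemma independent_monomials: "T.independent monomials"
  unfolding T.independent_explicit_finite_subsets
proof (intro allI impI ballI)
  fix S c s
  assume S: "S \<subseteq> monomials" "finite S" and 0: "(\<Sum>v\<in>S. sT (c v) v) = 0" and s: "s \<in> S"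
  obtain R where R: "R \<subseteq> {w. set w \<subseteq> B}" "finite R" "S = e ` R"
    using finite_subset_image[OF S(2) S(1)[unfolded monomials_def]] by blast
  have "inj_on e R" using inj_on_words R(1) by (rule inj_on_subset)
  then have "(\<Sum>w\<in>R. sT (c (e w)) (e w)) = 0" using 0 unfolding R(3) by (simp add: sum.reindex)
  from monomial_sum_eq_0[OF R(2) _ this] show "c s = 0" using R s by auto
qed

lemma e_in_span_monomials: "e vs \<in> T.span monomials"
proof (induction vs)
  case Nil
  show ?case by (rule T.span_base) (auto simp: monomials_def intro!: image_eqI[of _ _ "[]"])
next
  case (Cons v vs)
  have gen: "\<iota> b * x \<in> T.span monomials" if b: "b \<in> B" and x: "x \<in> T.span monomials" for b x
    using x
  proof (induction rule: T.span_induct)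
    case base
    show ?case using subspace_factor[OF T.subspace_span, of "\<iota> b" 1] by simp
  next
    case (step y)
    then obtain w where "set w \<subseteq> B" "y = e w" by (auto simp: monomials_def)
    then show ?case
      using b by (intro T.span_base) (auto simp: monomials_def e_Cons[symmetric])
  qed
  have "v \<in> V.span B" by (simp add: span_B)
  then have "\<iota> v * e vs \<in> T.span monomials"
  proof (induction rule: V.span_induct)
    case base
    show ?case using subspace_vector_factor[OF T.subspace_span, of 1] by simp
  next
    case (step b)
    then show ?case using gen Cons.IH by blast
  qed
  then show ?case by (simp add: e_Cons)
qed

lemma span_monomials: "T.span monomials = UNIV"
proof -
  have "(\<Union>k. tensor_power sT \<iota> k) \<subseteq> T.span monomials"
    unfolding tensor_power_def by (intro UN_least T.span_minimal) (auto intro: e_in_span_monomials)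
  then show ?thesis
    using sum_tensor_powers T.span_minimal[OF _ T.subspace_span] by blast
qed

section \<open>The ideal of dependent products\<close>

definition dependent_ideal :: "'t set" where
  "dependent_ideal = T.span (dependent_e_products sV \<iota>)"

text \<open>These span the kernel of the passage to the exterior algebra.  Adjacent exchanges
  are enough to move a letter past any word; repeated letters need a clause of their own, since
  \<open>2 m = 0\<close> does not give \<open>m = 0\<close> in characteristic 2.\<close>

definition alternating_relations :: "'t set" where
  "alternating_relations =
     {e w | w. set w \<subseteq> B \<and> \<not> distinct w} \<union>
     {e (us @ a # b # vs) + e (us @ b # a # vs) | us a b vs. set (us @ a # b # vs) \<subseteq> B}"

text \<open>A word times a generator times a word is again a generator, and the words span the algebra.\<close>

lemma alternating_relations_ideal:
  assumes x: "x \<in> T.span alternating_relations"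
  shows "y * x * z \<in> T.span alternating_relations"
proof -
  let ?N = "T.span alternating_relations"
  have gen: "e p * g * e q \<in> ?N"
    if g: "g \<in> alternating_relations" and pq: "set p \<subseteq> B" "set q \<subseteq> B" for g p q
  proof -
    consider w where "g = e w" "set w \<subseteq> B" "\<not> distinct w"
      | us a b vs where "g = e (us @ a # b # vs) + e (us @ b # a # vs)" "set (us @ a # b # vs) \<subseteq> B"
      using g unfolding alternating_relations_def by blast
    then show ?thesis
    proof cases
      case 1
      then have "e p * g * e q = e (p @ w @ q)" "set (p @ w @ q) \<subseteq> B" "\<not> distinct (p @ w @ q)"
        using pq by (auto simp: e_append mult.assoc)
      then show ?thesis
        by (intro T.span_base) (unfold alternating_relations_def, blast)
    next
      case g: 2
      have "e p * g * e q = e ((p @ us) @ a # b # (vs @ q)) + e ((p @ us) @ b # a # (vs @ q))"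
        by (simp add: g e_append e_Cons mult.assoc distrib_left distrib_right)
      moreover have "set ((p @ us) @ a # b # (vs @ q)) \<subseteq> B" using g pq by auto
      ultimately show ?thesis
        by (intro T.span_base) (unfold alternating_relations_def, blast)
    qed
  qed
  have words: "e p * x * e q \<in> ?N" if "set p \<subseteq> B" "set q \<subseteq> B" for p q
    using x by (induction rule: T.span_induct) (use subspace_factor gen that in auto)
  have left_word: "e p * x * z \<in> ?N" if p: "set p \<subseteq> B" for p
  proof -
    have "z \<in> T.span monomials" by (simp add: span_monomials)
    then show ?thesis
    proof (induction rule: T.span_induct)
      case base
      show ?case using subspace_factor[OF T.subspace_span, of "e p * x" 1] by simp
    next
      case (step m)
      then show ?case using words[OF p] by (auto simp: monomials_def)
    qed
  qed
  have "y \<in> T.span monomials" by (simp add: span_monomials)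
  then show ?thesis
  proof (induction rule: T.span_induct)
    case base
    show ?case using subspace_factor[OF T.subspace_span, of 1 "x * z"] by (simp add: mult.assoc)
  next
    case (step m)
    then show ?case using left_word by (auto simp: monomials_def)
  qed
qed

text \<open>The sum is bilinear in \<open>u\<close> and \<open>v\<close>, and for basis vectors it is a generator.\<close>

lemma anticommute:
  "\<iota> u * \<iota> v + \<iota> v * \<iota> u \<in> T.span alternating_relations"
proof -
  let ?N = "T.span alternating_relations"
  have sub: "V.subspace {v. x * \<iota> v + \<iota> v * x \<in> ?N}" for x
    unfolding V.subspace_def
  proof (intro conjI ballI allI)
    fix v w assume *: "v \<in> {v. x * \<iota> v + \<iota> v * x \<in> ?N}" "w \<in> {v. x * \<iota> v + \<iota> v * x \<in> ?N}"
    have "x * \<iota> (v + w) + \<iota> (v + w) * x = (x * \<iota> v + \<iota> v * x) + (x * \<iota> w + \<iota> w * x)"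
      by (simp add: incl.add algebra_simps)
    then show "v + w \<in> {v. x * \<iota> v + \<iota> v * x \<in> ?N}" using * by (auto intro: T.span_add)
  next
    fix c v assume *: "v \<in> {v. x * \<iota> v + \<iota> v * x \<in> ?N}"
    have "x * \<iota> (sV c v) + \<iota> (sV c v) * x = sT c (x * \<iota> v + \<iota> v * x)"
      by (simp add: incl.scale scale_mult_left scale_mult_right T.scale_right_distrib)
    then show "sV c v \<in> {v. x * \<iota> v + \<iota> v * x \<in> ?N}" using * by (auto intro: T.span_scale)
  qed (simp add: incl.zero T.span_zero)
  have basis: "\<iota> a * \<iota> b + \<iota> b * \<iota> a \<in> ?N" if "a \<in> B" "b \<in> B" for a b
  proof (rule T.span_base)
    have "\<iota> a * \<iota> b + \<iota> b * \<iota> a = e ([] @ a # b # []) + e ([] @ b # a # [])"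
      and "set ([] @ a # b # []) \<subseteq> B" using that by (simp_all add: e_Cons)
    then show "\<iota> a * \<iota> b + \<iota> b * \<iota> a \<in> alternating_relations"
      unfolding alternating_relations_def by blast
  qed
  have u: "u \<in> V.span B" and v: "v \<in> V.span B" by (simp_all add: span_B)
  have left: "\<iota> u * \<iota> b + \<iota> b * \<iota> u \<in> ?N" if "b \<in> B" for b
    using u by (induction rule: V.span_induct) (use sub[of "\<iota> b"] basis that in \<open>auto simp: add.commute\<close>)
  show ?thesis
    using v by (induction rule: V.span_induct) (use sub[of "\<iota> u"] left in auto)
qed

text \<open>The square of a sum differs from the sum of the squares by a term of the form treated in
  \<open>anticommute\<close>, so the vectors in question form a subspace.\<close>

lemma square:
  "\<iota> v * \<iota> v \<in> T.span alternating_relations"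
proof -
  let ?N = "T.span alternating_relations"
  have "v \<in> V.span B" by (simp add: span_B)
  then show ?thesis
  proof (induction rule: V.span_induct)
    case base
    show ?case
      unfolding V.subspace_def
    proof (intro conjI ballI allI)
      fix v w assume *: "v \<in> {v. \<iota> v * \<iota> v \<in> ?N}" "w \<in> {v. \<iota> v * \<iota> v \<in> ?N}"
      have "\<iota> (v + w) * \<iota> (v + w) = \<iota> v * \<iota> v + \<iota> w * \<iota> w + (\<iota> v * \<iota> w + \<iota> w * \<iota> v)"
        by (simp add: incl.add algebra_simps)
      then show "v + w \<in> {v. \<iota> v * \<iota> v \<in> ?N}"
        using * anticommute[of v w] by (simp only: mem_Collect_eq T.span_add)
    qed (simp_all add: incl.zero incl.scale T.span_zero T.span_scale scale_mult_left scale_mult_right)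
  next
    case (step b)
    have "\<iota> b * \<iota> b = e [b, b]" by (simp add: e_Cons)
    then show ?case using step by (intro T.span_base) (auto simp: alternating_relations_def)
  qed
qed

text \<open>The factor \<open>v\<close> in front is moved to the right until it meets its copy.\<close>

lemma repeated_factor:
  "v \<in> set vs \<Longrightarrow> \<iota> v * e vs \<in> T.span alternating_relations"
proof (induction vs)
  case (Cons a vs)
  let ?N = "T.span alternating_relations"
  show ?case
  proof (cases "v = a")
    case True
    then show ?thesis
      using alternating_relations_ideal[OF square, of 1 v "e vs"] by (simp add: e_Cons mult.assoc)
  next
    case False
    then have "\<iota> a * (\<iota> v * e vs) \<in> ?N"
      using alternating_relations_ideal[OF Cons.IH, of "\<iota> a" 1] Cons.prems by simp
    moreover have "(\<iota> v * \<iota> a + \<iota> a * \<iota> v) * e vs \<in> ?N"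
      using alternating_relations_ideal[OF anticommute, of 1 v a "e vs"] by simp
    ultimately have "(\<iota> v * \<iota> a + \<iota> a * \<iota> v) * e vs - \<iota> a * (\<iota> v * e vs) \<in> ?N"
      by (rule T.span_diff[rotated])
    then show ?thesis by (simp add: e_Cons algebra_simps)
  qed
qed simp

text \<open>The first factor, counted from the right, that depends on the factors behind it is a combination of
  these; expanding it leaves products with a repeated factor.\<close>

lemma dependent_e_product_in_span:
  "dependent_seq sV vs \<Longrightarrow> e vs \<in> T.span alternating_relations"
proof (induction vs)
  case Nil
  then show ?case by (simp add: dependent_seq_def V.independent_empty)
next
  case (Cons a vs)
  let ?N = "T.span alternating_relations"
  show ?case
  proof (cases "dependent_seq sV vs")
    case True
    then show ?thesis
      using alternating_relations_ideal[OF Cons.IH, of "\<iota> a" 1] by (simp add: e_Cons)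
  next
    case False
    have "a \<in> V.span (set vs)"
    proof (rule ccontr)
      assume a: "a \<notin> V.span (set vs)"
      then have "a \<notin> set vs" using V.span_base by blast
      then show False
        using Cons.prems False a V.independent_insertI[OF a] by (auto simp: dependent_seq_def)
    qed
    then have "\<iota> a * e vs \<in> ?N"
    proof (induction rule: V.span_induct)
      case base
      show ?case using subspace_vector_factor[OF T.subspace_span, of 1] by simp
    qed (rule repeated_factor)
    then show ?thesis by (simp add: e_Cons)
  qed
qed

lemma dependent_ideal_subset_span_alternating_relations: "dependent_ideal \<subseteq> T.span alternating_relations"
  unfolding dependent_ideal_def
  by (intro T.span_minimal) (auto simp: dependent_e_products_def intro: dependent_e_product_in_span)

lemma repeated_in_dependent_ideal: "\<not> distinct vs \<Longrightarrow> e vs \<in> dependent_ideal"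
  unfolding dependent_ideal_def
  by (intro T.span_base) (auto simp: dependent_e_products_def dependent_seq_def)

lemma subspace_dependent_ideal: "T.subspace dependent_ideal"
  by (simp add: dependent_ideal_def)

text \<open>Polarization: expand the product that has \<open>a + b\<close> in both places.\<close>

lemma swap_in_dependent_ideal: "e (us @ a # vs @ b # ws) + e (us @ b # vs @ a # ws) \<in> dependent_ideal"
proof -
  let ?f = "\<lambda>x y. e (us @ x # vs @ y # ws)"
  have "?f (a + b) (a + b) - ?f a a - ?f b b \<in> dependent_ideal"
    by (intro T.subspace_diff[OF subspace_dependent_ideal] repeated_in_dependent_ideal) auto
  moreover have "?f (a + b) (a + b) - ?f a a - ?f b b = ?f a b + ?f b a"
    by (simp add: e_append e_Cons incl.add algebra_simps)
  ultimately show ?thesis by simp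
qed

lemma transpose_in_dependent_ideal:
  assumes "i < length xs" "j < length xs" "i \<noteq> j"
  shows "e (permute_list (Transposition.transpose i j) xs) + e xs \<in> dependent_ideal"
proof -
  have *: "e (permute_list (Transposition.transpose i j) xs) + e xs \<in> dependent_ideal"
    if "i < j" "j < length xs" for i j
  proof -
    define us vs ws where "us = take i xs" and "vs = take (j - Suc i) (drop (Suc i) xs)"
      and "ws = drop (Suc j) xs"
    have "drop (Suc i) xs = vs @ xs ! j # ws"
      using that id_take_nth_drop[of "j - Suc i" "drop (Suc i) xs"]
      by (simp add: vs_def ws_def)
    then have xs: "xs = us @ xs ! i # vs @ xs ! j # ws"
      using that id_take_nth_drop[of i xs] by (simp add: us_def)
    have "length us = i" "length us + Suc (length vs) = j"
      using that by (simp_all add: us_def vs_def)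
    then have "permute_list (Transposition.transpose i j) xs = us @ xs ! j # vs @ xs ! i # ws"
      using permute_list_transpose[of us vs "xs ! i" "xs ! j" ws] xs by simp
    then show ?thesis using swap_in_dependent_ideal[of us "xs ! j" vs "xs ! i" ws] xs by simp
  qed
  show ?thesis
    using *[of i j] *[of j i] assms by (cases "i < j") (auto simp: transpose_commute)
qed

text \<open>A permutation is a product of transpositions, each of which changes the sign modulo the ideal; so the
  permutation acts by its own sign.\<close>

lemma permute_in_dependent_ideal:
  assumes "\<sigma> permutes {..<length xs}"
  shows "(if evenperm \<sigma> then e (permute_list \<sigma> xs) - e xs else e (permute_list \<sigma> xs) + e xs) \<in> dependent_ideal"
  using finite_lessThan assms
proof (induction \<sigma> rule: permutes_rev_induct)
  case id
  show ?case by (simp add: T.subspace_0[OF subspace_dependent_ideal])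
next
  case (swap i j \<sigma>)
  let ?ys = "permute_list \<sigma> xs"
  let ?zs = "permute_list (Transposition.transpose i j) ?ys"
  have "e ?zs + e ?ys \<in> dependent_ideal" by (rule transpose_in_dependent_ideal) (use swap in auto)
  then have ideal: "e ?zs + e ?ys - (e ?ys + x) \<in> dependent_ideal"
    if "e ?ys + x \<in> dependent_ideal" for x
    using that by (rule T.subspace_diff[OF subspace_dependent_ideal])
  have zs: "permute_list (\<sigma> \<circ> Transposition.transpose i j) xs = ?zs"
    using swap by (intro permute_list_compose permutes_swap_id) auto
  have parity: "evenperm (\<sigma> \<circ> Transposition.transpose i j) \<longleftrightarrow> \<not> evenperm \<sigma>"
    using evenperm_comp_transpose swap.hyps by blast
  show ?case
    unfolding zs parity using ideal[of "e xs"] ideal[of "- e xs"] swap.IH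
    by (cases "evenperm \<sigma>") simp_all
qed

lemma opposite_parity_sum_in_dependent_ideal:
  assumes "s \<in> same_parity_monomials \<iota> xs" "u \<in> opposite_parity_monomials \<iota> xs"
  shows "s + u \<in> dependent_ideal"
proof -
  have "s - e xs \<in> dependent_ideal" "u + e xs \<in> dependent_ideal"
    using assms permute_in_dependent_ideal
    by (fastforce simp: same_parity_monomials_def opposite_parity_monomials_def)+
  from T.subspace_add[OF subspace_dependent_ideal this] show ?thesis by simp
qed

end

section \<open>Chains of monomials\<close>

lemma monomials_of_both_parities:
  assumes "distinct xs"
  shows "same_parity_monomials \<iota> xs \<union> opposite_parity_monomials \<iota> xs =
    {e_product \<iota> w | w. distinct w \<and> set w = set xs}"
proof (intro equalityI subsetI)
  fix m assume "m \<in> same_parity_monomials \<iota> xs \<union> opposite_parity_monomials \<iota> xs"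
  then obtain \<sigma> where "m = e_product \<iota> (permute_list \<sigma> xs)" "\<sigma> permutes {..<length xs}"
    by (auto simp: same_parity_monomials_def opposite_parity_monomials_def)
  then show "m \<in> {e_product \<iota> w | w. distinct w \<and> set w = set xs}"
    using assms by auto
next
  fix m assume "m \<in> {e_product \<iota> w | w. distinct w \<and> set w = set xs}"
  then obtain w where w: "m = e_product \<iota> w" "distinct w" "set w = set xs" by blast
  obtain \<sigma> where "\<sigma> permutes {..<length xs}" "w = permute_list \<sigma> xs"
    using distinct_eq_permute_list[OF w(2) assms w(3)] .
  then show "m \<in> same_parity_monomials \<iota> xs \<union> opposite_parity_monomials \<iota> xs"
    unfolding w same_parity_monomials_def opposite_parity_monomials_def by blast
qed

locale monomial_chains = tensor_algebra_basis sV sT \<iota> B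
  for sV :: "'f::field \<Rightarrow> 'v::ab_group_add \<Rightarrow> 'v"
    and sT :: "'f \<Rightarrow> 't::ring_1 \<Rightarrow> 't"
    and \<iota> :: "'v \<Rightarrow> 't" and B :: "'v set" +
  fixes x :: "'v set \<Rightarrow> 'v list" and t :: "'v set \<Rightarrow> nat \<Rightarrow> 't"
  assumes x: "X \<in> nonempty_finite_subsets B \<Longrightarrow> distinct (x X) \<and> set (x X) = X"
    and t: "X \<in> nonempty_finite_subsets B \<Longrightarrow> monomial_enumeration \<iota> (x X) (t X)"
begin

abbreviation subsets :: "'v set set" where "subsets \<equiv> nonempty_finite_subsets B"

abbreviation K :: "'v set \<Rightarrow> nat" where "K X \<equiv> fact (card X)"

abbreviation T1 :: "'v set \<Rightarrow> 't set" where "T1 X \<equiv> same_parity_monomials \<iota> (x X)"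

abbreviation T2 :: "'v set \<Rightarrow> 't set" where "T2 X \<equiv> opposite_parity_monomials \<iota> (x X)"

lemma length_x: "X \<in> subsets \<Longrightarrow> length (x X) = card X"
  using x[of X] distinct_card[of "x X"] by simp

lemma subset_B: "X \<in> subsets \<Longrightarrow> X \<subseteq> B"
  by (simp add: nonempty_finite_subsets_def)

lemma T1_T2: "X \<in> subsets \<Longrightarrow> T1 X \<union> T2 X = {e w | w. distinct w \<and> set w = X}"
  using monomials_of_both_parities[of "x X" \<iota>] x[of X] by simp

text \<open>As the letters are distinct, a monomial determines the permutation that produces it.\<close>

lemma T1_T2_disjoint:
  assumes X: "X \<in> subsets"
  shows "T1 X \<inter> T2 X = {}"
proof (rule ccontr)
  assume "T1 X \<inter> T2 X \<noteq> {}"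
  then obtain \<sigma> \<tau> where *: "e (permute_list \<sigma> (x X)) = e (permute_list \<tau> (x X))"
    "\<sigma> permutes {..<length (x X)}" "evenperm \<sigma>" "\<tau> permutes {..<length (x X)}" "\<not> evenperm \<tau>"
    by (auto simp: same_parity_monomials_def opposite_parity_monomials_def)
  then have "permute_list \<sigma> (x X) = permute_list \<tau> (x X)"
    using e_eq_iff x[OF X] subset_B[OF X] by simp
  then show False using permute_list_inj x[OF X] * by blast
qed

lemma t_parity:
  assumes "X \<in> subsets"
  shows "bij_betw (t X) {i \<in> {1..K X}. odd i} (T1 X)"
    and "bij_betw (t X) {i \<in> {1..K X}. even i} (T2 X)"
  using t[OF assms] unfolding monomial_enumeration_def length_x[OF assms] by blast+

lemma bij_betw_t:
  assumes X: "X \<in> subsets"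
  shows "bij_betw (t X) {1..K X} {e w | w. distinct w \<and> set w = X}"
proof -
  have "{i \<in> {1..K X}. odd i} \<union> {i \<in> {1..K X}. even i} = {1..K X}" by blast
  then show ?thesis
    using bij_betw_combine[OF t_parity[OF X] T1_T2_disjoint[OF X]] T1_T2[OF X] by (simp only:)
qed

lemma t_word:
  assumes "X \<in> subsets" "i \<in> {1..K X}"
  obtains w where "t X i = e w" "distinct w" "set w = X"
  using bij_betwE[OF bij_betw_t[OF assms(1)]] assms(2) by blast

text \<open>From \<open>i\<close> to \<open>j\<close> the sums of consecutive elements telescope with alternating signs; the end term
  has sign \<open>+\<close> because \<open>i\<close> and \<open>j\<close> differ in parity.\<close>

lemma opposite_parity_sum_in:
  assumes J: "T.subspace J" and X: "X \<in> subsets"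
    and step: "\<And>i. 1 \<le> i \<Longrightarrow> i < K X \<Longrightarrow> t X i + t X (Suc i) \<in> J"
    and s: "s \<in> T1 X" and u: "u \<in> T2 X"
  shows "s + u \<in> J"
proof -
  have alt: "(if even n then t X i - t X (i + n) else t X i + t X (i + n)) \<in> J"
    if "1 \<le> i" "i + n \<le> K X" for i n
    using that(2)
  proof (induction n)
    case 0
    show ?case using T.subspace_0[OF J] by simp
  next
    case (Suc n)
    have next_link: "t X (i + n) + t X (i + Suc n) \<in> J" using step[of "i + n"] Suc.prems that(1) by simp
    show ?case
    proof (cases "even n")
      case True
      then have "t X i - t X (i + n) \<in> J" using Suc by simp
      from T.subspace_add[OF J this next_link] show ?thesis using True by simp
    next
      case False
      then have "t X i + t X (i + n) \<in> J" using Suc by simp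
      from T.subspace_diff[OF J this next_link] show ?thesis using False by simp
    qed
  qed
  obtain i j where ij: "s = t X i" "u = t X j" "i \<in> {1..K X}" "j \<in> {1..K X}" "odd i" "even j"
    using s u bij_betw_imp_surj_on[OF t_parity(1)[OF X]] bij_betw_imp_surj_on[OF t_parity(2)[OF X]]
    by blast
  show ?thesis
  proof (cases "i < j")
    case True
    then have "odd (j - i)" using ij by simp
    then show ?thesis using alt[of i "j - i"] ij True by simp
  next
    case False
    then have "odd (i - j)" using ij by auto
    then show ?thesis using alt[of j "i - j"] ij False by (simp add: add.commute)
  qed
qed

lemma t_eq_iff:
  assumes X: "X \<in> subsets" "i \<in> {1..K X}" and Y: "Y \<in> subsets" "j \<in> {1..K Y}"
  shows "t X i = t Y j \<longleftrightarrow> X = Y \<and> i = j"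
proof
  assume eq: "t X i = t Y j"
  obtain v w where v: "t X i = e v" "set v = X" and w: "t Y j = e w" "set w = Y"
    using t_word X Y by metis
  have "X = Y" using e_eq_iff[of v w] eq v w subset_B[OF X(1)] subset_B[OF Y(1)] by auto
  then show "X = Y \<and> i = j"
    using bij_betw_imp_inj_on[OF bij_betw_t[OF X(1)]] eq X Y by (auto simp: inj_on_def)
qed simp

definition places :: "('v set \<times> nat) set" where
  "places = (SIGMA X:subsets. {1..K X})"

text \<open>The place of a monomial in the chains.  Ranks start at 1, which leaves rank 0 for the monomials
  outside all chains, those with a repeated letter and \<open>1\<close>; these and the first elements of the
  chains are the monomials that \<open>link\<close> fixes.\<close>

definition place :: "'t \<Rightarrow> 'v set \<times> nat" where
  "place = inv_into places (\<lambda>(X, i). t X i)"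

definition rank :: "'t \<Rightarrow> nat" where
  "rank m = (if m \<in> (\<lambda>(X, i). t X i) ` places then snd (place m) else 0)"

definition link :: "'t \<Rightarrow> 't" where
  "link m = (if 1 < rank m then t (fst (place m)) (rank m - 1) + m else m)"

lemma inj_on_places: "inj_on (\<lambda>(X, i). t X i) places"
proof (rule inj_onI)
  fix p q
  assume p: "p \<in> places" and q: "q \<in> places"
    and eq: "(case p of (X, i) \<Rightarrow> t X i) = (case q of (X, i) \<Rightarrow> t X i)"
  obtain X i where X: "p = (X, i)" "X \<in> subsets" "i \<in> {1..K X}"
    using p unfolding places_def by blast
  obtain Y j where Y: "q = (Y, j)" "Y \<in> subsets" "j \<in> {1..K Y}"
    using q unfolding places_def by blast
  have "t X i = t Y j" using eq unfolding X(1) Y(1) prod.case .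
  then show "p = q" using t_eq_iff[OF X(2,3) Y(2,3)] X(1) Y(1) by blast
qed

lemma place_t:
  assumes "X \<in> subsets" "i \<in> {1..K X}"
  shows "place (t X i) = (X, i)"
proof -
  have "(X, i) \<in> places" using assms unfolding places_def by blast
  from inv_into_f_f[OF inj_on_places this] show ?thesis unfolding place_def prod.case .
qed

lemma rank_t: "X \<in> subsets \<Longrightarrow> i \<in> {1..K X} \<Longrightarrow> rank (t X i) = i"
proof -
  assume X: "X \<in> subsets" "i \<in> {1..K X}"
  then have "(\<lambda>(X, i). t X i) (X, i) \<in> (\<lambda>(X, i). t X i) ` places"
    unfolding places_def by blast
  then show ?thesis using place_t[OF X] by (simp add: rank_def)
qed

lemma link_t_1: "X \<in> subsets \<Longrightarrow> link (t X 1) = t X 1"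
  using rank_t[of X 1] by (simp add: link_def)

lemma link_t_Suc:
  assumes "X \<in> subsets" "1 \<le> i" "i < K X"
  shows "link (t X (Suc i)) = t X i + t X (Suc i)"
  using assms place_t[of X "Suc i"] rank_t[of X "Suc i"] by (simp add: link_def)

lemma rank_eq_0:
  assumes "set w \<subseteq> B" "\<not> distinct w \<or> w = []"
  shows "rank (e w) = 0"
proof -
  have "e w \<notin> (\<lambda>(X, i). t X i) ` places"
  proof
    assume "e w \<in> (\<lambda>(X, i). t X i) ` places"
    then obtain X i where X: "X \<in> subsets" "i \<in> {1..K X}" "e w = t X i"
      by (auto simp: places_def)
    obtain w' where "t X i = e w'" "distinct w'" "set w' = X" using t_word X by metis
    then have "w = w'" "X \<noteq> {}"
      using e_eq_iff[of w w'] X assms subset_B[OF X(1)] by (auto simp: nonempty_finite_subsets_def)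
    then show False using assms \<open>distinct w'\<close> \<open>set w' = X\<close> by auto
  qed
  then show ?thesis by (simp add: rank_def)
qed

lemma link_not_distinct: "set w \<subseteq> B \<Longrightarrow> \<not> distinct w \<or> w = [] \<Longrightarrow> link (e w) = e w"
  using rank_eq_0 by (simp add: link_def)

definition later_monomials :: "'t set" where
  "later_monomials = {t X (Suc i) | X i. X \<in> subsets \<and> 1 \<le> i \<and> i < K X}"

definition heads :: "'t set" where
  "heads = (\<Union>X\<in>subsets. {t X 1}) \<union> {1}"

abbreviation A0 :: "'t set" where "A0 \<equiv> dependent_basis_monomials sV \<iota> B"

abbreviation A1 :: "'t set" where "A1 \<equiv> \<Union>X\<in>subsets. chain_set (K X) (t X) - {t X 1}"

lemma A0_eq: "A0 = e ` {w. set w \<subseteq> B \<and> \<not> distinct w}"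
  using V.independent_mono[OF indep_B]
  by (auto simp: dependent_basis_monomials_def dependent_seq_def)

lemma monomials_eq: "monomials = A0 \<union> later_monomials \<union> heads"
proof (intro equalityI subsetI)
  fix m assume "m \<in> monomials"
  then obtain w where w: "m = e w" "set w \<subseteq> B" by (auto simp: monomials_def)
  consider "\<not> distinct w" | "w = []" | "distinct w" "w \<noteq> []" by blast
  then show "m \<in> A0 \<union> later_monomials \<union> heads"
  proof cases
    case 1
    then show ?thesis using w by (auto simp: A0_eq)
  next
    case 2
    then show ?thesis using w by (simp add: heads_def)
  next
    case 3
    then have X: "set w \<in> subsets" using w by (auto simp: nonempty_finite_subsets_def)
    have "m \<in> t (set w) ` {1..K (set w)}"
      using bij_betw_imp_surj_on[OF bij_betw_t[OF X]] 3 w by blast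
    then obtain i where i: "m = t (set w) i" "1 \<le> i" "i \<le> K (set w)" by auto
    show ?thesis
    proof (cases "i = 1")
      case True
      then show ?thesis using X i by (auto simp: heads_def)
    next
      case False
      then show ?thesis
        unfolding later_monomials_def using X i
        by (intro UnI1 UnI2 CollectI exI[of _ "set w"] exI[of _ "i - 1"]) auto
    qed
  qed
next
  have t_mono: "t X i \<in> monomials" if "X \<in> subsets" "i \<in> {1..K X}" for X i
    using t_word[OF that] subset_B[OF that(1)] by (metis (mono_tags) imageI mem_Collect_eq monomials_def)
  fix m assume "m \<in> A0 \<union> later_monomials \<union> heads"
  moreover have "1 \<in> monomials" by (auto simp: monomials_def intro!: image_eqI[of _ _ "[]"])
  ultimately show "m \<in> monomials"
    using t_mono by (auto simp: A0_eq later_monomials_def heads_def) (auto simp: monomials_def)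
qed

lemma link_unitriangular:
  assumes "m \<in> monomials"
  shows "link m - m \<in> T.span {m' \<in> monomials. rank m' < rank m}"
proof (cases "1 < rank m")
  case True
  then have "m \<in> (\<lambda>(X, i). t X i) ` places" by (auto simp: rank_def split: if_splits)
  then obtain X i where X: "X \<in> subsets" "i \<in> {1..K X}" "m = t X i"
    by (auto simp: places_def)
  have i: "1 < i" using True X rank_t by simp
  then have j: "i - 1 \<in> {1..K X}" using X(2) by auto
  obtain w where w: "t X (i - 1) = e w" "set w = X" using t_word[OF X(1) j] by metis
  have "link m - m = t X (i - 1)"
    using i X place_t rank_t by (simp add: link_def)
  then show ?thesis
    using w subset_B[OF X(1)] X rank_t[OF X(1) j] rank_t[OF X(1,2)] i
    by (intro T.span_base) (auto simp: monomials_def)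
qed (simp add: link_def T.span_zero)

lemmas change_of_basis =
  T.unitriangular_change_of_basis[OF independent_monomials link_unitriangular]

text \<open>The rank tells the later monomials of a chain from its head, and the letters of a word tell a
  dependent monomial from a head.\<close>

lemma heads_disjoint: "(A0 \<union> later_monomials) \<inter> heads = {}"
proof -
  have rank_1: "rank 1 = 0" using rank_eq_0[of "[]"] by simp
  have rank_head: "rank (t X 1) = 1" if "X \<in> subsets" for X using rank_t[of X 1] that by simp
  have "m \<notin> heads" if m: "m \<in> A0" for m
  proof -
    obtain w where w: "m = e w" "set w \<subseteq> B" "\<not> distinct w" using m by (auto simp: A0_eq)
    then have "m \<noteq> 1" using e_eq_iff[of w "[]"] by auto
    moreover have "rank m = 0" using rank_eq_0 w by simp
    ultimately show ?thesis using rank_head by (force simp: heads_def)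
  qed
  moreover have "m \<notin> heads" if "m \<in> later_monomials" for m
  proof -
    have "1 < rank m" using that rank_t by (auto simp: later_monomials_def)
    then show ?thesis using rank_1 rank_head by (force simp: heads_def)
  qed
  ultimately show ?thesis by blast
qed

text \<open>Removing \<open>t\<^sub>1\<close> from the chain set removes none of the sums, since \<open>link\<close> is injective.\<close>

lemma chain_links:
  assumes X: "X \<in> subsets"
  shows "chain_set (K X) (t X) - {t X 1} = {t X i + t X (Suc i) | i. 1 \<le> i \<and> i < K X}"
proof -
  have "t X i + t X (Suc i) \<noteq> t X 1" if i: "1 \<le> i" "i < K X" for i
  proof
    assume "t X i + t X (Suc i) = t X 1"
    then have "link (t X (Suc i)) = link (t X 1)" using link_t_1 link_t_Suc X i by simp
    moreover have "t X (Suc i) \<in> monomials" "t X 1 \<in> monomials"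
      using X i by (auto simp: monomials_eq later_monomials_def heads_def)
    ultimately have "t X (Suc i) = t X 1" using change_of_basis(1) by (simp add: inj_on_def)
    then show False using t_eq_iff[of X "Suc i" X 1] X i by simp
  qed
  then show ?thesis by (auto simp: chain_set_def)
qed

lemma A1_eq: "A1 = {t X i + t X (Suc i) | X i. X \<in> subsets \<and> 1 \<le> i \<and> i < K X}"
proof -
  have "A1 = (\<Union>X\<in>subsets. {t X i + t X (Suc i) | i. 1 \<le> i \<and> i < K X})"
    by (rule SUP_cong[OF refl]) (rule chain_links)
  then show ?thesis by blast
qed

lemma link_image: "link ` (A0 \<union> later_monomials) = A0 \<union> A1" and link_heads: "link ` heads = heads"
proof -
  have "link m = m" if "m \<in> A0" for m
    using that link_not_distinct by (auto simp: A0_eq)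
  then have "link ` A0 = A0" by simp
  moreover have "link ` later_monomials = A1"
    unfolding A1_eq
  proof (intro equalityI subsetI)
    fix y assume "y \<in> link ` later_monomials"
    then obtain X i where X: "X \<in> subsets" "1 \<le> i" "i < K X" and "y = link (t X (Suc i))"
      unfolding later_monomials_def by blast
    then have "y = t X i + t X (Suc i)" by (simp only: link_t_Suc)
    with X show "y \<in> {t X i + t X (Suc i) | X i. X \<in> subsets \<and> 1 \<le> i \<and> i < K X}" by blast
  next
    fix y assume "y \<in> {t X i + t X (Suc i) | X i. X \<in> subsets \<and> 1 \<le> i \<and> i < K X}"
    then obtain X i where X: "X \<in> subsets" "1 \<le> i" "i < K X" and "y = t X i + t X (Suc i)"
      by blast
    then have "y = link (t X (Suc i))" by (simp only: link_t_Suc)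
    with X show "y \<in> link ` later_monomials" unfolding later_monomials_def by blast
  qed
  ultimately show "link ` (A0 \<union> later_monomials) = A0 \<union> A1" by (simp only: image_Un)
  have "link m = m" if m: "m \<in> heads" for m
  proof -
    consider X where "X \<in> subsets" "m = t X 1" | "m = e []"
      using m unfolding heads_def e_Nil by blast
    then show ?thesis
      by cases (use link_t_1 link_not_distinct[of "[]"] in simp_all)
  qed
  then show "link ` heads = heads" by simp
qed

text \<open>A word with distinct letters and the one obtained by an adjacent exchange are monomials on the same
  set, of opposite parity relative to its enumeration.\<close>

lemma span_alternating_relations_subset: "T.span alternating_relations \<subseteq> T.span (A0 \<union> A1)"
proof (rule T.span_minimal)
  let ?N = "T.span (A0 \<union> A1)"
  have rep: "e w \<in> ?N" if "set w \<subseteq> B" "\<not> distinct w" for w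
    using that by (intro T.span_base) (auto simp: A0_eq)
  have swap: "e (us @ a # b # vs) + e (us @ b # a # vs) \<in> ?N"
    if B: "set (us @ a # b # vs) \<subseteq> B" for us a b vs
  proof (cases "distinct (us @ a # b # vs)")
    case False
    then show ?thesis using B by (intro T.span_add rep) auto
  next
    case True
    define X where "X = set (us @ a # b # vs)"
    have X: "X \<in> subsets" using B by (auto simp: X_def nonempty_finite_subsets_def)
    obtain \<sigma> where \<sigma>: "\<sigma> permutes {..<length (x X)}" "us @ a # b # vs = permute_list \<sigma> (x X)"
      using distinct_eq_permute_list[OF True, of "x X"] x[OF X] X_def by metis
    let ?\<tau> = "Transposition.transpose (length us) (Suc (length us))"
    have len: "length (x X) = length us + Suc (Suc (length vs))"
      using \<sigma>(2) by (metis length_append length_Cons length_permute_list)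
    have \<tau>: "?\<tau> permutes {..<length (x X)}" using len by (intro permutes_swap_id) auto
    have "permute_list (\<sigma> \<circ> ?\<tau>) (x X) = us @ b # a # vs"
      using permute_list_compose[OF \<tau>, of \<sigma>] \<sigma>(2) permute_list_transpose[of us "[]" a b vs]
      by simp
    moreover have "\<sigma> \<circ> ?\<tau> permutes {..<length (x X)}" using \<sigma>(1) \<tau> by (rule permutes_compose[rotated])
    moreover have "evenperm (\<sigma> \<circ> ?\<tau>) \<longleftrightarrow> \<not> evenperm \<sigma>"
      using evenperm_comp_transpose \<sigma>(1) by (metis n_not_Suc_n)
    ultimately have "e (us @ a # b # vs) \<in> T1 X \<and> e (us @ b # a # vs) \<in> T2 X \<or>
        e (us @ a # b # vs) \<in> T2 X \<and> e (us @ b # a # vs) \<in> T1 X"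
      using \<sigma> unfolding same_parity_monomials_def opposite_parity_monomials_def
      by (metis (mono_tags, lifting) mem_Collect_eq)
    moreover have sum: "s + u \<in> ?N" if "s \<in> T1 X" "u \<in> T2 X" for s u
    proof (rule opposite_parity_sum_in[OF T.subspace_span X _ that])
      show "t X i + t X (Suc i) \<in> ?N" if "1 \<le> i" "i < K X" for i
        unfolding A1_eq using that X by (intro T.span_base) blast
    qed
    ultimately show ?thesis
      using sum[of "e (us @ a # b # vs)"] sum[of "e (us @ b # a # vs)" "e (us @ a # b # vs)"]
      unfolding add.commute[of "e (us @ b # a # vs)"] by blast
  qed
  show "alternating_relations \<subseteq> ?N"
    unfolding alternating_relations_def
  proof (intro Un_least subsetI)
    fix y assume "y \<in> {e w | w. set w \<subseteq> B \<and> \<not> distinct w}"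
    then show "y \<in> ?N" using rep by blast
  next
    fix y assume "y \<in> {e (us @ a # b # vs) + e (us @ b # a # vs) | us a b vs. set (us @ a # b # vs) \<subseteq> B}"
    then show "y \<in> ?N" using swap by blast
  qed
qed simp

lemma span_A0_A1: "T.span (A0 \<union> A1) = dependent_ideal"
proof (intro equalityI)
  have "t X i + t X (Suc i) \<in> dependent_ideal" if X: "X \<in> subsets" and i: "1 \<le> i" "i < K X" for X i
  proof -
    have "t X j \<in> (if odd j then T1 X else T2 X)" if "j \<in> {1..K X}" for j
      using t_parity[OF X] that by (auto simp: bij_betw_def)
    from this[of i] this[of "Suc i"] show ?thesis
      using opposite_parity_sum_in_dependent_ideal[of "t X i" "x X" "t X (Suc i)"]
        opposite_parity_sum_in_dependent_ideal[of "t X (Suc i)" "x X" "t X i"] i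
      by (cases "odd i") (auto simp: add.commute)
  qed
  moreover have "A0 \<subseteq> dependent_ideal"
    using repeated_in_dependent_ideal by (auto simp: A0_eq)
  ultimately show "T.span (A0 \<union> A1) \<subseteq> dependent_ideal"
    unfolding A1_eq by (intro T.span_minimal subspace_dependent_ideal) blast
  show "dependent_ideal \<subseteq> T.span (A0 \<union> A1)"
    using dependent_ideal_subset_span_alternating_relations span_alternating_relations_subset by blast
qed

lemma two_sided_ideal_dependent_ideal: "two_sided_ideal dependent_ideal"
proof -
  have eq: "dependent_ideal = T.span alternating_relations"
    using dependent_ideal_subset_span_alternating_relations span_alternating_relations_subset
      span_A0_A1 by blast
  show ?thesis
    unfolding two_sided_ideal_def eq
    using alternating_relations_ideal[of _ _ 1] alternating_relations_ideal[of _ 1]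
    by (auto simp: T.span_zero T.span_add)
qed

lemma span_chain:
  assumes X: "X \<in> subsets"
  shows "T.span (chain_set (K X) (t X)) = T.span (T1 X \<union> T2 X)"
proof -
  have img: "T1 X \<union> T2 X = t X ` {1..K X}"
    using bij_betw_imp_surj_on[OF bij_betw_t[OF X]] T1_T2[OF X] by simp
  have "t X i \<in> T.span (chain_set (K X) (t X))" if "1 \<le> i" "i \<le> K X" for i
    using that
  proof (induction i rule: dec_induct)
    case base
    show ?case by (rule T.span_base) (simp add: chain_set_def)
  next
    case (step i)
    then have "t X i + t X (Suc i) \<in> T.span (chain_set (K X) (t X))"
      by (intro T.span_base) (auto simp: chain_set_def)
    from T.span_diff[OF this step.IH] show ?case using step by simp
  qed
  moreover have "t X 1 \<in> T.span (t X ` {1..K X})"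
    by (rule T.span_base) simp
  moreover have "t X i + t X (Suc i) \<in> T.span (t X ` {1..K X})" if "1 \<le> i" "i < K X" for i
    using that by (intro T.span_add T.span_base) auto
  ultimately show ?thesis
    unfolding img T.span_eq by (auto simp: chain_set_def)
qed

lemma basis_and_complement:
  shows "is_basis_of sT (A0 \<union> A1 \<union> heads) UNIV"
    and "is_basis_of sT (A0 \<union> A1) dependent_ideal"
    and "complementary_subspaces sT dependent_ideal (T.span heads)"
    and "is_basis_of sT heads (T.span heads)"
proof -
  have img: "link ` monomials = A0 \<union> A1 \<union> heads"
    by (simp only: monomials_eq image_Un link_heads flip: link_image)
  have ind: "T.independent (A0 \<union> A1 \<union> heads)" and span: "T.span (A0 \<union> A1 \<union> heads) = UNIV"
    using change_of_basis(2,3) span_monomials unfolding img by simp_all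
  have "link ` (A0 \<union> later_monomials) \<inter> link ` heads = link ` ((A0 \<union> later_monomials) \<inter> heads)"
    using inj_on_image_Int[OF change_of_basis(1)] by (metis Un_upper1 Un_upper2 monomials_eq)
  then have disj: "(A0 \<union> A1) \<inter> heads = {}"
    by (simp only: link_image link_heads heads_disjoint image_empty)
  show "is_basis_of sT (A0 \<union> A1 \<union> heads) UNIV"
    using ind span by (simp add: is_basis_of_def)
  show "is_basis_of sT (A0 \<union> A1) dependent_ideal"
    using T.independent_mono[OF ind, of "A0 \<union> A1"] span_A0_A1 by (simp add: is_basis_of_def)
  show "complementary_subspaces sT dependent_ideal (T.span heads)"
    using T.complementary_spans[OF ind disj span] by (simp only: span_A0_A1)
  show "is_basis_of sT heads (T.span heads)"
    using T.independent_mono[OF ind, of heads] by (simp add: is_basis_of_def)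
qed

end

theorem mainTheorem1:
  fixes sV :: "'f::field \<Rightarrow> 'v::ab_group_add \<Rightarrow> 'v"
    and sT :: "'f \<Rightarrow> 't::ring_1 \<Rightarrow> 't"
    and \<iota> :: "'v \<Rightarrow> 't"
    and B :: "'v set"
    and x :: "'v set \<Rightarrow> 'v list"
    and t :: "'v set \<Rightarrow> nat \<Rightarrow> 't"
    and T\<^sub>1 T\<^sub>2 T :: "'v set \<Rightarrow> 't set"
    and A\<^sub>0 A\<^sub>1 E D :: "'t set"
  assumes tensor_algebra: "tensor_algebra sV sT \<iota>"
    and basis: "is_basis_of sV B UNIV"
    and x: "\<And>X. X \<in> nonempty_finite_subsets B \<Longrightarrow> distinct (x X) \<and> set (x X) = X"
    and t: "\<And>X. X \<in> nonempty_finite_subsets B \<Longrightarrow> monomial_enumeration \<iota> (x X) (t X)"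
  defines "T\<^sub>1 \<equiv> \<lambda>X. same_parity_monomials \<iota> (x X)"
    and "T\<^sub>2 \<equiv> \<lambda>X. opposite_parity_monomials \<iota> (x X)"
    and "T \<equiv> \<lambda>X. chain_set (fact (card X)) (t X)"
    and "A\<^sub>0 \<equiv> dependent_basis_monomials sV \<iota> B"
    and "A\<^sub>1 \<equiv> \<Union>X\<in>nonempty_finite_subsets B. T X - {t X 1}"
    and "E \<equiv> (\<Union>X\<in>nonempty_finite_subsets B. {t X 1}) \<union> {1}"
    and "D \<equiv> module.span sT (dependent_e_products sV \<iota>)"
  shows "(\<forall>X\<in>nonempty_finite_subsets B.
            module.span sT (T X) = module.span sT (T\<^sub>1 X \<union> T\<^sub>2 X) \<and>
            (\<forall>s\<in>T\<^sub>1 X. \<forall>u\<in>T\<^sub>2 X. s + u \<in> module.span sT (T X - {t X 1}))) \<and>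
         is_basis_of sT (A\<^sub>0 \<union> A\<^sub>1 \<union> E) UNIV \<and>
         two_sided_ideal D \<and> is_basis_of sT (A\<^sub>0 \<union> A\<^sub>1) D \<and>
         (\<exists>W. complementary_subspaces sT D W \<and> is_basis_of sT E W)"
proof -
  have B: "\<not> module.dependent sV B" "module.span sV B = UNIV"
    using basis by (simp_all add: is_basis_of_def)
  interpret chains: monomial_chains sV sT \<iota> B x t
    using tensor_algebra B x t
    by (simp add: monomial_chains_def monomial_chains_axioms_def tensor_algebra_basis_def
        tensor_algebra_basis_axioms_def)
  have D: "D = chains.dependent_ideal" by (simp add: D_def chains.dependent_ideal_def)
  have E: "E = chains.heads" by (simp add: E_def chains.heads_def)
  have "s + u \<in> module.span sT (T X - {t X 1})"
    if "X \<in> nonempty_finite_subsets B" "s \<in> T\<^sub>1 X" "u \<in> T\<^sub>2 X" for X s u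
  proof (rule chains.opposite_parity_sum_in[OF chains.T.subspace_span that(1)])
    show "t X i + t X (Suc i) \<in> module.span sT (T X - {t X 1})" if "1 \<le> i" "i < fact (card X)" for i
      unfolding T_def chains.chain_links[OF \<open>X \<in> nonempty_finite_subsets B\<close>]
      by (rule chains.T.span_base) (use that in blast)
  qed (use that in \<open>simp_all add: T\<^sub>1_def T\<^sub>2_def\<close>)
  moreover have "module.span sT (T X) = module.span sT (T\<^sub>1 X \<union> T\<^sub>2 X)"
    if "X \<in> nonempty_finite_subsets B" for X
    unfolding T_def T\<^sub>1_def T\<^sub>2_def by (rule chains.span_chain[OF that])
  moreover have "A\<^sub>1 = (\<Union>X\<in>nonempty_finite_subsets B. chain_set (fact (card X)) (t X) - {t X 1})"
    by (simp only: A\<^sub>1_def T_def)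
  ultimately show ?thesis
    using chains.basis_and_complement chains.two_sided_ideal_dependent_ideal
    unfolding D E A\<^sub>0_def by metis
qed

end
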